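(* Let $\Phi=\{\varphi_i\}_{i=1}^M$ be a frame for $\mathcal{H}_N$. Consider the two problems $$\text{(C)}\quad \min_{c_1,\dots,c_M\ge 0}\operatorname{cond}\Big(\sum_{i=1}^M c_i\varphi_i\varphi_i^*\Big),\qquad \text{(O)}\quad \min_{c_1,\dots,c_M\ge 0}\Big\|I_N-\sum_{i=1}^M c_i\varphi_i\varphi_i^*\Big\|_2 .$$ These problems are equivalent in the following sense. (a) Solving (O) gives the minimal condition number: if $(c_i')_{i=1}^M$ with $c_i'\ge0$ attains the minimum in (O) and $T_\Phi=\sum_{i=1}^M c_i'\varphi_i\varphi_i^*$, then $T_\Phi$ has the smallest condition number among the operators $\{\sum_{i=1}^M c_i\varphi_i\varphi_i^* : c_i\ge 0\}$. (b) If $(d_i)_{i=1}^M$ with $d_i\ge 0$ attains the minimum in (C), then there is some $c>0$ such that $(cd_i)_{i=1}^M$ attains the minimum in (O). As a consequence of (a), every $T_\Phi$ as in (a) satisfies $\operatorname{cond}(T_\Phi)\le\operatorname{cond}(\Phi\Phi^* )$, where $\Phi\Phi^*=\sum_{i=1}^M\varphi_i\varphi_i^*$.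
   Context: $\mathcal{H}_N$ is an $N$-dimensional (real or complex) Hilbert space, identified with coordinate space so that vectors are columns and $\varphi^*$ is the (conjugate) transpose. A frame for $\mathcal{H}_N$ is a finite family $\{\varphi_i\}_{i=1}^M$ for which there are constants $0<A\le B<\infty$ with $A\|x\|^2\le\sum_{i=1}^M|\langle x,\varphi_i\rangle|^2\le B\|x\|^2$ for all $x\in\mathcal{H}_N$ (equivalently, a spanning family). $\Phi$ also denotes the $N\times M$ matrix with columns $\varphi_i$. $I_N$ is the identity matrix and $\|\cdot\|_2$ is the operator norm of a matrix. For a square matrix $T$, $\operatorname{cond}(T)$ is the largest singular value of $T$ divided by the smallest singular value of $T$, with $\operatorname{cond}(T)=\infty$ if $T$ is singular. *)

theory Defs
  imports "HOL-Analysis.Analysis"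
begin

text \<open>
  The scalar field, real or complex. Up to isomorphism the only models of this class are the
  reals and the complex numbers, with their usual absolute value and conjugation; both are
  shown to be instances below.
\<close>

class real_or_complex = real_normed_field + euclidean_space +
  fixes conjg :: "'a \<Rightarrow> 'a"
  assumes conjg_add: "conjg (x + y) = conjg x + conjg y"
    and conjg_mult: "conjg (x * y) = conjg x * conjg y"
    and conjg_conjg: "conjg (conjg x) = x"
    and mult_conjg: "x * conjg x = (norm x)\<^sup>2 *\<^sub>R 1"

instantiation real :: real_or_complex
begin

definition conjg_real :: "real \<Rightarrow> real" where "conjg_real x = x"

instance
  by standard (simp_all add: conjg_real_def power2_eq_square)

end

instantiation complex :: real_or_complex
begin

definition conjg_complex :: "complex \<Rightarrow> complex" where "conjg_complex = cnj"

instance proof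
  fix x :: complex
  show "x * conjg x = (norm x)\<^sup>2 *\<^sub>R 1"
    by (simp only: conjg_complex_def complex_norm_square[symmetric] scaleR_conv_of_real mult_1_right)
qed (simp_all add: conjg_complex_def)

end

text \<open>
  On \<open>'k ^ 'n\<close> the library norm is the Euclidean (Hilbert space) norm, but the library inner
  product is real-valued; this is the scalar-valued one, linear in the first argument.
\<close>

definition sinner :: "('k::real_or_complex) ^ 'n \<Rightarrow> 'k ^ 'n \<Rightarrow> 'k" where
  "sinner x y = (\<Sum>j\<in>UNIV. x $ j * conjg (y $ j))"

definition frame :: "('m::finite \<Rightarrow> ('k::real_or_complex) ^ 'n) \<Rightarrow> bool" where
  "frame \<phi> \<longleftrightarrow> (\<exists>A B::real. 0 < A \<and> A \<le> B \<and>
     (\<forall>x. A * (norm x)\<^sup>2 \<le> (\<Sum>i\<in>UNIV. (norm (sinner x (\<phi> i)))\<^sup>2) \<and>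
          (\<Sum>i\<in>UNIV. (norm (sinner x (\<phi> i)))\<^sup>2) \<le> B * (norm x)\<^sup>2))"

definition ctranspose :: "('k::real_or_complex) ^ 'm ^ 'n \<Rightarrow> 'k ^ 'n ^ 'm" where
  "ctranspose A = (\<chi> i j. conjg (A $ j $ i))"

definition frame_matrix :: "('m::finite \<Rightarrow> ('k::real_or_complex) ^ 'n) \<Rightarrow> 'k ^ 'm ^ 'n" where
  "frame_matrix \<phi> = (\<chi> j i. \<phi> i $ j)"

text \<open>The rank-one matrix \<open>v v\<^sup>*\<close>.\<close>

definition outer :: "('k::real_or_complex) ^ 'n \<Rightarrow> 'k ^ 'n ^ 'n" where
  "outer v = (\<chi> i j. v $ i * conjg (v $ j))"

definition weighted_sum ::
    "('m::finite \<Rightarrow> ('k::real_or_complex) ^ 'n) \<Rightarrow> ('m \<Rightarrow> real) \<Rightarrow> 'k ^ 'n ^ 'n" where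
  "weighted_sum \<phi> c = (\<Sum>i\<in>UNIV. c i *\<^sub>R outer (\<phi> i))"

definition op_norm :: "('k::real_or_complex) ^ 'n ^ 'n \<Rightarrow> real" where
  "op_norm T = onorm (\<lambda>x. T *v x)"

text \<open>The nonnegative square roots of the eigenvalues of \<open>T\<^sup>* T\<close>.\<close>

definition singular_values :: "('k::real_or_complex) ^ 'n ^ 'n \<Rightarrow> real set" where
  "singular_values T =
     {\<sigma>. 0 \<le> \<sigma> \<and> (\<exists>x. x \<noteq> 0 \<and> (ctranspose T ** T) *v x = \<sigma>\<^sup>2 *\<^sub>R x)}"

definition cond :: "('k::real_or_complex) ^ 'n ^ 'n \<Rightarrow> ereal" where
  "cond T = (if invertible T
             then ereal (Max (singular_values T) / Min (singular_values T)) else \<infinity>)"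

definition solves_C ::
    "('m::finite \<Rightarrow> ('k::real_or_complex) ^ 'n) \<Rightarrow> ('m \<Rightarrow> real) \<Rightarrow> bool" where
  "solves_C \<phi> = is_arg_min (\<lambda>c. cond (weighted_sum \<phi> c)) (\<lambda>c. \<forall>i. 0 \<le> c i)"

definition solves_O ::
    "('m::finite \<Rightarrow> ('k::real_or_complex) ^ 'n) \<Rightarrow> ('m \<Rightarrow> real) \<Rightarrow> bool" where
  "solves_O \<phi> = is_arg_min (\<lambda>c. op_norm (mat 1 - weighted_sum \<phi> c)) (\<lambda>c. \<forall>i. 0 \<le> c i)"

end

theory Submission
  imports Defs
begin

text \<open>
  Both objective functions depend on \<open>T = \<Sum>\<^sub>i c\<^sub>i \<phi>\<^sub>i \<phi>\<^sub>i\<^sup>*\<close> only through its extreme eigenvalues. Since \<open>T\<close>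
  is Hermitian and positive semidefinite, with smallest eigenvalue \<open>a\<close> and largest eigenvalue
  \<open>b\<close>, we have \<open>cond T = b / a\<close> (infinite when \<open>a = 0\<close>) and
  \<open>\<parallel>I - T\<parallel> = max \<bar>1 - a\<bar> \<bar>1 - b\<bar>\<close>. These are the lemmas \<open>cond_eq\<close> and \<open>onorm_id_minus\<close>.

  The weights range over a cone, so \<open>T\<close> may be replaced by \<open>t T\<close>, which leaves \<open>cond\<close>
  alone. For \<open>a > 0\<close>, over all scalings with \<open>t > 0\<close>, the smallest value of \<open>\<parallel>I - t T\<parallel>\<close> is
  \<open>(b - a) / (b + a)\<close>, attained at \<open>t = 2 / (a + b)\<close> (lemmas \<open>dist_one_ge_ratio\<close> and
  \<open>dist_one_optimal_scaling\<close>). This is \<open>(\<kappa> - 1) / (\<kappa> + 1)\<close> with \<open>\<kappa> = b / a\<close>, a strictly increasing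
  function of the condition number. Hence a minimiser of the norm has the smallest condition
  number, and a minimiser of the condition number, suitably rescaled, minimises the norm.

  The frame hypothesis excludes the degenerate case in which every \<open>T\<close> is singular: there all
  condition numbers are infinite and being a minimiser for \<open>cond\<close> carries no information.

  The spectral theory is carried out for a self-adjoint operator on a real Euclidean space.
  Real and complex scalars are covered at once because the library inner product on
  \<open>'k ^ 'n\<close> is the real part of the scalar-valued one, the norms agree, and the eigenvalues
  in question are real.
\<close>

section \<open>Extremal eigenvalues of self-adjoint operators\<close>

definition self_adjoint :: "('a::euclidean_space \<Rightarrow> 'a) \<Rightarrow> bool" where
  "self_adjoint f \<longleftrightarrow> linear f \<and> (\<forall>x y. f x \<bullet> y = x \<bullet> f y)"

text \<open>
  The extreme eigenvalues are characterised by their eigenvectors and the bounds on the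
  quadratic form (the Rayleigh quotient), so that the spectrum as a set never has to be computed.
\<close>

definition extremal_eigenvalues :: "('a::euclidean_space \<Rightarrow> 'a) \<Rightarrow> real \<Rightarrow> real \<Rightarrow> bool" where
  "extremal_eigenvalues f a b \<longleftrightarrow>
     (\<exists>u. u \<noteq> 0 \<and> f u = a *\<^sub>R u) \<and> (\<exists>v. v \<noteq> 0 \<and> f v = b *\<^sub>R v) \<and>
     (\<forall>x. a * (norm x)\<^sup>2 \<le> f x \<bullet> x \<and> f x \<bullet> x \<le> b * (norm x)\<^sup>2)"

lemma self_adjoint_linear: "self_adjoint f \<Longrightarrow> linear f"
  by (simp add: self_adjoint_def)

lemma self_adjoint_inner: "self_adjoint f \<Longrightarrow> f x \<bullet> y = x \<bullet> f y"
  by (simp add: self_adjoint_def)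

lemma self_adjoint_affine:
  assumes "self_adjoint f"
  shows "self_adjoint (\<lambda>x. c *\<^sub>R x + d *\<^sub>R f x)"
proof -
  have "linear (\<lambda>x. c *\<^sub>R x + d *\<^sub>R f x)"
    using self_adjoint_linear[OF assms]
    by (intro linearI) (simp_all add: linear_add linear_scale algebra_simps)
  then show ?thesis
    using self_adjoint_inner[OF assms]
    by (simp add: self_adjoint_def inner_add_left inner_add_right)
qed

text \<open>
  The quadratic form is nonnegative along the line \<open>x + t (f x)\<close> and vanishes at \<open>t = 0\<close>; so
  its linear coefficient \<open>2 \<parallel>f x\<parallel>\<^sup>2\<close> must vanish.
\<close>

lemma positive_form_null_vector:
  assumes f: "self_adjoint f" and pos: "\<And>y. 0 \<le> f y \<bullet> y" and null: "f x \<bullet> x = 0"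
  shows "f x = 0"
proof (rule ccontr)
  assume "f x \<noteq> 0"
  define p where "p = f x \<bullet> f x"
  define q where "q = f (f x) \<bullet> f x"
  have p: "p > 0" using \<open>f x \<noteq> 0\<close> by (simp add: p_def)
  have q: "q \<ge> 0" using pos by (simp add: q_def)
  define t where "t = - (p / (q + 1))"
  have "f (x + t *\<^sub>R f x) \<bullet> (x + t *\<^sub>R f x) = 2 * t * p + t\<^sup>2 * q"
    using null self_adjoint_linear[OF f] self_adjoint_inner[OF f, of "f x" x]
    by (simp add: linear_add linear_scale inner_add_left inner_add_right p_def q_def
        power2_eq_square algebra_simps)
  then have "0 \<le> 2 * t * p + t\<^sup>2 * q" using pos by metis
  also have "\<dots> = - (p\<^sup>2 * (q + 2)) / (q + 1)\<^sup>2"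
    using q by (simp add: t_def power2_eq_square divide_simps) (simp add: algebra_simps)
  also have "\<dots> < 0" using p q by (simp add: divide_simps)
  finally show False by simp
qed

text \<open>A maximiser of the quadratic form on the compact unit sphere is an eigenvector.\<close>

lemma largest_eigenvalue_exists:
  fixes f :: "'a::euclidean_space \<Rightarrow> 'a"
  assumes f: "self_adjoint f"
  shows "\<exists>b v. v \<noteq> 0 \<and> f v = b *\<^sub>R v \<and> (\<forall>x. f x \<bullet> x \<le> b * (norm x)\<^sup>2)"
proof -
  note lin = self_adjoint_linear[OF f]
  have "sphere (0::'a) 1 \<noteq> {}" by simp
  moreover have "continuous_on (sphere 0 1) (\<lambda>x. f x \<bullet> x)"
    using lin by (intro continuous_intros linear_continuous_on) (simp add: linear_conv_bounded_linear)
  ultimately have "\<exists>v\<in>sphere (0::'a) 1. \<forall>y\<in>sphere 0 1. f y \<bullet> y \<le> f v \<bullet> v"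
    using compact_sphere by (rule continuous_attains_sup[rotated])
  then obtain v where v: "norm v = 1" and max: "\<And>y. norm y = 1 \<Longrightarrow> f y \<bullet> y \<le> f v \<bullet> v"
    by auto
  define b where "b = f v \<bullet> v"
  have bound: "f x \<bullet> x \<le> b * (norm x)\<^sup>2" for x
  proof (cases "x = 0")
    case True
    then show ?thesis by simp
  next
    case False
    define y where "y = x /\<^sub>R norm x"
    have "norm y = 1" and x: "x = norm x *\<^sub>R y" using False by (simp_all add: y_def)
    have "f x \<bullet> x = (norm x)\<^sup>2 * (f y \<bullet> y)"
      by (subst (1 2) x) (simp add: linear_scale[OF lin] power2_eq_square)
    also have "\<dots> \<le> (norm x)\<^sup>2 * b"
      using max[OF \<open>norm y = 1\<close>] by (intro mult_left_mono) (simp_all add: b_def)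
    finally show ?thesis by (simp add: mult.commute)
  qed
  define g where "g = (\<lambda>x. b *\<^sub>R x + (-1) *\<^sub>R f x)"
  have "g v = 0"
  proof (rule positive_form_null_vector[of g v])
    show "self_adjoint g" unfolding g_def using f by (rule self_adjoint_affine)
    show "0 \<le> g y \<bullet> y" for y
      using bound[of y] by (simp add: g_def inner_diff_left power2_norm_eq_inner)
    show "g v \<bullet> v = 0"
      using v by (simp add: g_def inner_diff_left b_def power2_norm_eq_inner[symmetric])
  qed
  then have "f v = b *\<^sub>R v" by (simp add: g_def)
  moreover have "v \<noteq> 0" using v by auto
  ultimately show ?thesis using bound by blast
qed

lemma extremal_eigenvalues_exist:
  assumes f: "self_adjoint f"
  shows "\<exists>a b. extremal_eigenvalues f a b"
proof -
  have "self_adjoint (\<lambda>x. - f x)" using self_adjoint_affine[OF f, of 0 "-1"] by simp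
  from largest_eigenvalue_exists[OF this] obtain a' u
    where u: "u \<noteq> 0" "- f u = a' *\<^sub>R u" "\<forall>x. - f x \<bullet> x \<le> a' * (norm x)\<^sup>2" by blast
  from largest_eigenvalue_exists[OF f] obtain b v
    where v: "v \<noteq> 0" "f v = b *\<^sub>R v" "\<forall>x. f x \<bullet> x \<le> b * (norm x)\<^sup>2" by blast
  have "f u = (- a') *\<^sub>R u" using u(2) by (metis minus_minus scaleR_minus_left)
  moreover have "(- a') * (norm x)\<^sup>2 \<le> f x \<bullet> x" for x
    using u(3)[rule_format, of x] by simp
  ultimately have "extremal_eigenvalues f (- a') b"
    using u(1) v unfolding extremal_eigenvalues_def by blast
  then show ?thesis by blast
qed

lemma eigenvalue_bounds:
  assumes "extremal_eigenvalues f a b" and "x \<noteq> 0" and "f x = s *\<^sub>R x"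
  shows "a \<le> s \<and> s \<le> b"
proof -
  have "f x \<bullet> x = s * (norm x)\<^sup>2" using assms(3) by (simp add: power2_norm_eq_inner)
  moreover have "a * (norm x)\<^sup>2 \<le> f x \<bullet> x \<and> f x \<bullet> x \<le> b * (norm x)\<^sup>2"
    using assms(1) by (simp add: extremal_eigenvalues_def)
  moreover have "(norm x)\<^sup>2 > 0" using assms(2) by simp
  ultimately show ?thesis by simp
qed

lemma extremal_eigenvalues_le: "extremal_eigenvalues f a b \<Longrightarrow> a \<le> b"
  using eigenvalue_bounds by (metis extremal_eigenvalues_def)

lemma extremal_eigenvalues_ge:
  assumes "extremal_eigenvalues f a b" and "\<And>x. l * (norm x)\<^sup>2 \<le> f x \<bullet> x"
  shows "l \<le> a"
proof -
  obtain u where u: "u \<noteq> 0" "f u = a *\<^sub>R u"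
    using assms(1) by (auto simp: extremal_eigenvalues_def)
  have "l * (norm u)\<^sup>2 \<le> a * (norm u)\<^sup>2"
    using assms(2)[of u] u by (simp add: power2_norm_eq_inner)
  then show ?thesis using u(1) by simp
qed

lemma extremal_eigenvalues_scaleR:
  assumes "extremal_eigenvalues f a b" and "0 \<le> t"
  shows "extremal_eigenvalues (\<lambda>x. t *\<^sub>R f x) (t * a) (t * b)"
proof -
  have "\<exists>u. u \<noteq> 0 \<and> t *\<^sub>R f u = (t * s) *\<^sub>R u" if "\<exists>u. u \<noteq> 0 \<and> f u = s *\<^sub>R u" for s
    using that by auto
  moreover have "t * a * (norm x)\<^sup>2 \<le> t *\<^sub>R f x \<bullet> x \<and> t *\<^sub>R f x \<bullet> x \<le> t * b * (norm x)\<^sup>2" for x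
    using assms by (simp add: extremal_eigenvalues_def mult.assoc mult_left_mono)
  ultimately show ?thesis using assms(1) unfolding extremal_eigenvalues_def by blast
qed

text \<open>Eigenvectors for distinct eigenvalues are orthogonal, and orthogonal families are finite.\<close>

lemma finite_eigenvalues:
  assumes f: "self_adjoint f"
  shows "finite {s::real. \<exists>x. x \<noteq> 0 \<and> f x = s *\<^sub>R x}" (is "finite ?E")
proof -
  have "\<forall>s\<in>?E. \<exists>x. x \<noteq> 0 \<and> f x = s *\<^sub>R x" by simp
  from bchoice[OF this] obtain w where w: "\<And>s. s \<in> ?E \<Longrightarrow> w s \<noteq> 0 \<and> f (w s) = s *\<^sub>R w s"
    by blast
  have orth: "w s \<bullet> w t = 0" if "s \<in> ?E" "t \<in> ?E" "s \<noteq> t" for s t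
    using self_adjoint_inner[OF f, of "w s" "w t"] w[OF that(1)] w[OF that(2)] that(3) by simp
  have "inj_on w ?E"
  proof (rule inj_onI, rule ccontr)
    fix s t assume st: "s \<in> ?E" "t \<in> ?E" "w s = w t" "s \<noteq> t"
    have "w s \<bullet> w s = 0" using orth[OF st(1,2,4)] st(3) by simp
    then show False using w[OF st(1)] by simp
  qed
  moreover have "pairwise orthogonal (w ` ?E)"
  proof (rule pairwiseI)
    fix x y assume "x \<in> w ` ?E" "y \<in> w ` ?E" "x \<noteq> y"
    then obtain s t where st: "s \<in> ?E" "t \<in> ?E" "x = w s" "y = w t" by blast
    then have "s \<noteq> t" using \<open>x \<noteq> y\<close> by blast
    from orth[OF st(1,2) this] show "orthogonal x y" by (simp add: orthogonal_def st(3,4))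
  qed
  ultimately show ?thesis
    using pairwise_orthogonal_imp_finite finite_imageD by blast
qed

text \<open>
  For a self-adjoint operator a bound on the quadratic form is a bound on the operator:
  polarization gives \<open>4 (f x \<bullet> y) \<le> 2 m (\<parallel>x\<parallel>\<^sup>2 + \<parallel>y\<parallel>\<^sup>2)\<close>, and \<open>y\<close> is taken along \<open>f x\<close> with
  \<open>\<parallel>y\<parallel> = \<parallel>x\<parallel>\<close>.
\<close>

lemma self_adjoint_norm_bound:
  assumes f: "self_adjoint f" and m: "\<And>x. \<bar>f x \<bullet> x\<bar> \<le> m * (norm x)\<^sup>2"
  shows "norm (f x) \<le> m * norm x"
proof (cases "x = 0 \<or> f x = 0")
  case True
  have "0 \<le> m * norm x"
  proof (cases "x = 0")
    case False
    have "0 \<le> m * (norm x)\<^sup>2" using m[of x] by linarith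
    then show ?thesis using False by (simp add: zero_le_mult_iff)
  qed simp
  then show ?thesis using True linear_0[OF self_adjoint_linear[OF f]] by auto
next
  case False
  define y where "y = (norm x / norm (f x)) *\<^sub>R f x"
  have ny: "norm y = norm x" using False by (simp add: y_def)
  have fxy: "f x \<bullet> y = norm x * norm (f x)"
    using False by (simp add: y_def power2_norm_eq_inner[symmetric] power2_eq_square)
  have "4 * (f x \<bullet> y) = f (x + y) \<bullet> (x + y) - f (x - y) \<bullet> (x - y)"
    using self_adjoint_linear[OF f] self_adjoint_inner[OF f, of y x]
    by (simp add: linear_add linear_diff inner_add_left inner_add_right inner_diff_left
        inner_diff_right inner_commute)
  also have "\<dots> \<le> m * (norm (x + y))\<^sup>2 + m * (norm (x - y))\<^sup>2"
    using m[of "x + y"] m[of "x - y"] by linarith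
  also have "\<dots> = m * (2 * (norm x)\<^sup>2 + 2 * (norm y)\<^sup>2)"
    by (simp add: power2_norm_eq_inner inner_add_left inner_add_right inner_diff_left
        inner_diff_right inner_commute algebra_simps)
  finally have "norm x * norm (f x) \<le> norm x * (m * norm x)"
    using fxy ny by (simp add: power2_eq_square mult.left_commute)
  then show ?thesis using False by simp
qed

text \<open>
  The eigenvectors for \<open>a\<close> and \<open>b\<close> give one inequality, the bounds on the quadratic form of
  \<open>I - f\<close> the other.
\<close>

lemma onorm_id_minus:
  assumes f: "self_adjoint f" and ext: "extremal_eigenvalues f a b"
  shows "onorm (\<lambda>x. x - f x) = max \<bar>1 - a\<bar> \<bar>1 - b\<bar>"
proof (rule antisym)
  let ?g = "\<lambda>x. x - f x"
  have g: "self_adjoint ?g" using self_adjoint_affine[OF f, of 1 "-1"] by simp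
  show "onorm ?g \<le> max \<bar>1 - a\<bar> \<bar>1 - b\<bar>"
  proof (rule onorm_le, rule self_adjoint_norm_bound[OF g])
    fix x
    have "a * (norm x)\<^sup>2 \<le> f x \<bullet> x" "f x \<bullet> x \<le> b * (norm x)\<^sup>2"
      using ext by (simp_all add: extremal_eigenvalues_def)
    then have "\<bar>?g x \<bullet> x\<bar> \<le> max \<bar>(1 - a) * (norm x)\<^sup>2\<bar> \<bar>(1 - b) * (norm x)\<^sup>2\<bar>"
      by (simp add: inner_diff_left power2_norm_eq_inner[symmetric] left_diff_distrib)
    also have "\<dots> = max \<bar>1 - a\<bar> \<bar>1 - b\<bar> * (norm x)\<^sup>2"
      by (simp add: abs_mult max_mult_distrib_right)
    finally show "\<bar>?g x \<bullet> x\<bar> \<le> max \<bar>1 - a\<bar> \<bar>1 - b\<bar> * (norm x)\<^sup>2" .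
  qed
  have bl: "bounded_linear ?g"
    using self_adjoint_linear[OF g] by (simp add: linear_conv_bounded_linear)
  have "\<bar>1 - s\<bar> \<le> onorm ?g" if "x \<noteq> 0" "f x = s *\<^sub>R x" for s x
  proof -
    have "?g x = (1 - s) *\<^sub>R x" using that(2) by (simp add: algebra_simps)
    then have "norm (?g x) / norm x = \<bar>1 - s\<bar>" using that(1) by simp
    then show ?thesis using le_onorm[OF bl, of x] by simp
  qed
  then show "max \<bar>1 - a\<bar> \<bar>1 - b\<bar> \<le> onorm ?g"
    using ext by (auto simp: extremal_eigenvalues_def)
qed

section \<open>Optimal scaling\<close>

text \<open>
  If \<open>[a, b]\<close> lies in \<open>[1 - m, 1 + m]\<close> with \<open>m < 1\<close>, then \<open>b / a \<le> (1 + m) / (1 - m)\<close>; solving for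
  \<open>m\<close> gives the bound.
\<close>

lemma dist_one_ge_ratio:
  fixes a b :: real
  assumes "0 < a" "a \<le> b"
  shows "(b - a) / (b + a) \<le> max \<bar>1 - a\<bar> \<bar>1 - b\<bar>"
proof -
  define m where "m = max \<bar>1 - a\<bar> \<bar>1 - b\<bar>"
  have m: "0 \<le> m" "1 - a \<le> m" "b - 1 \<le> m" by (auto simp: m_def)
  have "b * (1 - m) \<le> a * (1 + m)"
  proof (cases "m \<le> 1")
    case True
    have "b * (1 - m) \<le> (1 + m) * (1 - m)" using m True by (intro mult_right_mono) auto
    also have "\<dots> = (1 - m) * (1 + m)" by simp
    also have "\<dots> \<le> a * (1 + m)" using m by (intro mult_right_mono) auto
    finally show ?thesis .
  next
    case False
    then have "b * (1 - m) \<le> 0" using assms by (simp add: mult_le_0_iff)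
    also have "0 \<le> a * (1 + m)" using assms m by simp
    finally show ?thesis .
  qed
  then show ?thesis using assms by (simp add: m_def[symmetric] divide_simps algebra_simps)
qed

text \<open>The scaling for which the eigenvalues \<open>t a\<close> and \<open>t b\<close> lie symmetrically about \<open>1\<close>.\<close>

lemma dist_one_optimal_scaling:
  fixes a b :: real
  assumes "0 < a" "a \<le> b"
  shows "max \<bar>1 - 2 / (a + b) * a\<bar> \<bar>1 - 2 / (a + b) * b\<bar> = (b - a) / (b + a)"
proof -
  have "1 - 2 / (a + b) * a = (b - a) / (b + a)" "1 - 2 / (a + b) * b = - ((b - a) / (b + a))"
    using assms by (simp_all add: divide_simps)
  then show ?thesis using assms by simp
qed

text \<open>Both sides compare the quotients \<open>b / a\<close>, since \<open>\<kappa> \<mapsto> (\<kappa> - 1) / (\<kappa> + 1)\<close> is increasing.\<close>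

lemma ratio_le_iff:
  fixes a b a' b' :: real
  assumes "0 < a" "a \<le> b" "0 < a'" "a' \<le> b'"
  shows "(b' - a') / (b' + a') \<le> (b - a) / (b + a) \<longleftrightarrow> b' / a' \<le> b / a"
proof -
  have "(b' - a') / (b' + a') \<le> (b - a) / (b + a) \<longleftrightarrow> (b' - a') * (b + a) \<le> (b - a) * (b' + a')"
    using assms by (simp add: divide_simps mult.commute)
  also have "\<dots> \<longleftrightarrow> b' * a \<le> b * a'" by (simp add: algebra_simps)
  also have "\<dots> \<longleftrightarrow> b' / a' \<le> b / a" using assms by (simp add: divide_simps mult.commute)
  finally show ?thesis .
qed

section \<open>Conjugation and adjoints over the scalar field\<close>

text \<open>
  Polarizing \<open>x conjg x = \<parallel>x\<parallel>\<^sup>2\<close> shows that the real inner product of two scalars is the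
  Hermitian part of \<open>x conjg y\<close>.
\<close>

lemma inner_conjg:
  fixes x y :: "'k::real_or_complex"
  shows "(2 * (x \<bullet> y)) *\<^sub>R 1 = x * conjg y + y * conjg x"
proof -
  have "((norm (x + y))\<^sup>2) *\<^sub>R (1::'k) = (x + y) * conjg (x + y)" by (simp add: mult_conjg)
  also have "\<dots> = x * conjg x + y * conjg y + (x * conjg y + y * conjg x)"
    by (simp add: conjg_add algebra_simps)
  also have "x * conjg x + y * conjg y = ((norm x)\<^sup>2 + (norm y)\<^sup>2) *\<^sub>R 1"
    by (simp add: mult_conjg scaleR_add_left)
  finally have "x * conjg y + y * conjg x
      = ((norm (x + y))\<^sup>2 - ((norm x)\<^sup>2 + (norm y)\<^sup>2)) *\<^sub>R 1"
    by (simp add: scaleR_diff_left)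
  also have "(norm (x + y))\<^sup>2 - ((norm x)\<^sup>2 + (norm y)\<^sup>2) = 2 * (x \<bullet> y)"
    by (simp add: power2_norm_eq_inner inner_add_left inner_add_right inner_commute)
  finally show ?thesis by simp
qed

lemma inner_mult_conjg:
  fixes u x y :: "'k::real_or_complex"
  shows "(u * x) \<bullet> y = x \<bullet> (conjg u * y)"
proof -
  have "(2 * ((u * x) \<bullet> y)) *\<^sub>R (1::'k) = (2 * (x \<bullet> (conjg u * y))) *\<^sub>R 1"
    by (simp only: inner_conjg) (simp add: conjg_mult conjg_conjg mult_ac)
  then show ?thesis by simp
qed

lemma conjg_zero: "conjg (0::'k::real_or_complex) = 0"
  using conjg_add[of "0::'k" 0] by simp

lemma conjg_sum: "conjg (\<Sum>i\<in>A. f i :: 'k::real_or_complex) = (\<Sum>i\<in>A. conjg (f i))"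
  by (induction A rule: infinite_finite_induct) (simp_all add: conjg_zero conjg_add)

lemma conjg_scaleR_one: "conjg (r *\<^sub>R (1::'k::real_or_complex)) = r *\<^sub>R 1"
proof (cases "r = 0")
  case True
  then show ?thesis by (simp add: conjg_zero)
next
  case False
  have "r *\<^sub>R (1::'k) * conjg (r *\<^sub>R 1) = r *\<^sub>R (r *\<^sub>R 1)"
    by (simp only: mult_conjg) (simp add: power2_eq_square)
  then have "r *\<^sub>R conjg (r *\<^sub>R (1::'k)) = r *\<^sub>R (r *\<^sub>R 1)" by simp
  then show ?thesis using False by (rule scaleR_left_imp_eq[rotated])
qed

lemma conjg_scaleR: "conjg (r *\<^sub>R (x::'k::real_or_complex)) = r *\<^sub>R conjg x"
  using conjg_mult[of "r *\<^sub>R 1" x] by (simp add: conjg_scaleR_one)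

lemma inner_smult_left_sinner:
  fixes v y :: "('k::real_or_complex) ^ 'n"
  shows "(s *s v) \<bullet> y = s \<bullet> sinner y v"
proof -
  have "(s * v $ i) \<bullet> (y $ i) = s \<bullet> (y $ i * conjg (v $ i))" for i
    using inner_mult_conjg[of "v $ i" s "y $ i"] by (simp add: mult.commute)
  then show ?thesis by (simp add: inner_vec_def sinner_def inner_sum_right)
qed

section \<open>The operators \<open>\<Sum>\<^sub>i c\<^sub>i \<phi>\<^sub>i \<phi>\<^sub>i\<^sup>*\<close>\<close>

lemma outer_mult_vec: "outer v *v x = sinner x v *s v"
  by (simp add: vec_eq_iff matrix_vector_mult_def outer_def sinner_def sum_distrib_left
      sum_distrib_right mult_ac)

lemma scaleR_matrix_mult_vec:
  fixes A :: "('k::real_or_complex) ^ 'n ^ 'm"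
  shows "(r *\<^sub>R A) *v x = r *\<^sub>R (A *v x)"
  by (simp add: vec_eq_iff matrix_vector_mult_def scaleR_sum_right)

lemma weighted_sum_mult_vec:
  fixes \<phi> :: "'m::finite \<Rightarrow> ('k::real_or_complex) ^ 'n"
  shows "weighted_sum \<phi> c *v x = (\<Sum>i\<in>UNIV. c i *\<^sub>R (sinner x (\<phi> i) *s \<phi> i))"
proof -
  have "(\<Sum>i\<in>S. M i) *v x = (\<Sum>i\<in>S. M i *v x)"
    for S and M :: "'m \<Rightarrow> 'k ^ 'n ^ 'n"
    by (induction S rule: infinite_finite_induct)
      (simp_all add: matrix_vector_mult_add_rdistrib)
  then show ?thesis
    by (simp add: weighted_sum_def scaleR_matrix_mult_vec outer_mult_vec)
qed

text \<open>
  The scalars \<open>\<langle>x, \<phi>\<^sub>i\<rangle>\<close> and \<open>\<langle>y, \<phi>\<^sub>i\<rangle>\<close> enter symmetrically, which is what makes the operator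
  self-adjoint; and for \<open>x = y\<close> the summands are nonnegative multiples of the weights.
\<close>

lemma inner_weighted_sum:
  "(weighted_sum \<phi> c *v x) \<bullet> y = (\<Sum>i\<in>UNIV. c i * (sinner x (\<phi> i) \<bullet> sinner y (\<phi> i)))"
  by (simp add: weighted_sum_mult_vec inner_sum_left inner_smult_left_sinner)

lemma self_adjoint_weighted_sum: "self_adjoint ((*v) (weighted_sum \<phi> c))"
proof -
  have "(weighted_sum \<phi> c *v x) \<bullet> y = (weighted_sum \<phi> c *v y) \<bullet> x" for x y
    by (simp only: inner_weighted_sum) (simp add: inner_commute)
  then show ?thesis
    by (simp add: self_adjoint_def inner_commute)
qed

lemma inner_weighted_sum_self:
  "(weighted_sum \<phi> c *v x) \<bullet> x = (\<Sum>i\<in>UNIV. c i * (norm (sinner x (\<phi> i)))\<^sup>2)"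
  by (simp add: inner_weighted_sum power2_norm_eq_inner)

lemma smallest_eigenvalue_nonneg:
  assumes "\<And>i. 0 \<le> c i" and "extremal_eigenvalues ((*v) (weighted_sum \<phi> c)) a b"
  shows "0 \<le> a"
  using assms(2) by (rule extremal_eigenvalues_ge) (simp add: inner_weighted_sum_self sum_nonneg assms(1))

lemma ctranspose_weighted_sum: "ctranspose (weighted_sum \<phi> c) = weighted_sum \<phi> c"
  by (simp add: vec_eq_iff ctranspose_def weighted_sum_def outer_def conjg_sum conjg_scaleR
      conjg_mult conjg_conjg mult.commute)

lemma weighted_sum_scaleR: "weighted_sum \<phi> (\<lambda>i. t * c i) = t *\<^sub>R weighted_sum \<phi> c"
  by (simp add: weighted_sum_def scaleR_sum_right)

lemma frame_matrix_mult_ctranspose: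
  "frame_matrix \<phi> ** ctranspose (frame_matrix \<phi>) = (\<Sum>i\<in>UNIV. outer (\<phi> i))"
  by (simp add: vec_eq_iff matrix_matrix_mult_def frame_matrix_def ctranspose_def outer_def)

lemma op_norm_weighted_sum:
  assumes "extremal_eigenvalues ((*v) (weighted_sum \<phi> c)) a b"
  shows "op_norm (mat 1 - weighted_sum \<phi> c) = max \<bar>1 - a\<bar> \<bar>1 - b\<bar>"
  using onorm_id_minus[OF self_adjoint_weighted_sum assms]
  by (simp add: op_norm_def matrix_vector_mult_diff_rdistrib)

lemma op_norm_scaled_weighted_sum:
  assumes "extremal_eigenvalues ((*v) (weighted_sum \<phi> c)) a b" "0 < a"
  shows "op_norm (mat 1 - weighted_sum \<phi> (\<lambda>i. 2 / (a + b) * c i)) = (b - a) / (b + a)"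
proof -
  have ab: "a \<le> b" using assms(1) by (rule extremal_eigenvalues_le)
  have "extremal_eigenvalues (\<lambda>x. (2 / (a + b)) *\<^sub>R (weighted_sum \<phi> c *v x))
      (2 / (a + b) * a) (2 / (a + b) * b)"
    using assms ab by (intro extremal_eigenvalues_scaleR) auto
  then have "extremal_eigenvalues ((*v) (weighted_sum \<phi> (\<lambda>i. 2 / (a + b) * c i)))
      (2 / (a + b) * a) (2 / (a + b) * b)"
    by (simp only: weighted_sum_scaleR scaleR_matrix_mult_vec[abs_def])
  from op_norm_weighted_sum[OF this] show ?thesis
    using dist_one_optimal_scaling[OF assms(2) ab] by simp
qed

section \<open>The condition number\<close>

lemma invertible_iff_no_null_vector:
  fixes A :: "('k::field) ^ 'n ^ 'n"
  shows "invertible A \<longleftrightarrow> (\<forall>x. A *v x = 0 \<longrightarrow> x = 0)"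
  by (simp add: invertible_left_inverse matrix_left_invertible_ker)

text \<open>
  For a Hermitian matrix with positive eigenvalues the singular values are the eigenvalues.
  If \<open>T (T x) = \<sigma>\<^sup>2 x\<close>, then \<open>y = T x + \<sigma> x\<close> satisfies \<open>T y = \<sigma> y\<close>, and \<open>y \<noteq> 0\<close> because \<open>-\<sigma>\<close>
  cannot be an eigenvalue.
\<close>

lemma singular_values_eq_eigenvalues:
  assumes herm: "ctranspose T = T" and f: "self_adjoint ((*v) T)"
    and ext: "extremal_eigenvalues ((*v) T) a b" and a: "0 < a"
  shows "singular_values T = {s. \<exists>x. x \<noteq> 0 \<and> T *v x = s *\<^sub>R x}"
proof -
  note lin = self_adjoint_linear[OF f]
  show ?thesis
  proof (rule set_eqI, rule iffI)
    fix s assume "s \<in> singular_values T"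
    then obtain x where s: "0 \<le> s" and x: "x \<noteq> 0" "T *v (T *v x) = s\<^sup>2 *\<^sub>R x"
      by (auto simp: singular_values_def herm matrix_vector_mul_assoc)
    define y where "y = T *v x + s *\<^sub>R x"
    have "T *v y = s *\<^sub>R y"
      using lin x(2) by (simp add: y_def linear_add linear_scale power2_eq_square algebra_simps)
    moreover have "y \<noteq> 0"
    proof
      assume "y = 0"
      then have "T *v x = (- s) *\<^sub>R x" by (simp add: y_def add_eq_0_iff2)
      from eigenvalue_bounds[OF ext x(1) this] show False using a s by simp
    qed
    ultimately show "s \<in> {s. \<exists>x. x \<noteq> 0 \<and> T *v x = s *\<^sub>R x}" by blast
  next
    fix s assume "s \<in> {s. \<exists>x. x \<noteq> 0 \<and> T *v x = s *\<^sub>R x}"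
    then obtain x where x: "x \<noteq> 0" "T *v x = s *\<^sub>R x" by blast
    have "0 \<le> s" using eigenvalue_bounds[OF ext x] a by linarith
    moreover have "T *v (T *v x) = s\<^sup>2 *\<^sub>R x"
      using lin x(2) by (simp add: linear_scale power2_eq_square)
    ultimately show "s \<in> singular_values T"
      using x(1) by (auto simp: singular_values_def herm matrix_vector_mul_assoc)
  qed
qed

lemma cond_eq:
  assumes herm: "ctranspose T = T" and f: "self_adjoint ((*v) T)"
    and ext: "extremal_eigenvalues ((*v) T) a b" and a: "0 \<le> a"
  shows "cond T = (if 0 < a then ereal (b / a) else \<infinity>)"
proof (cases "0 < a")
  case True
  have inv: "invertible T"
    unfolding invertible_iff_no_null_vector
    \<comment> \<open>a null vector would be an eigenvector for the eigenvalue \<open>0 < a\<close>\<close>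
    using eigenvalue_bounds[OF ext, of _ 0] True by (auto simp: not_le)
  note sv = singular_values_eq_eigenvalues[OF herm f ext True]
  have fin: "finite (singular_values T)" unfolding sv by (rule finite_eigenvalues[OF f])
  have "a \<in> singular_values T" "b \<in> singular_values T"
    using ext by (simp_all add: sv extremal_eigenvalues_def)
  moreover have "a \<le> s \<and> s \<le> b" if "s \<in> singular_values T" for s
    using that eigenvalue_bounds[OF ext] by (auto simp: sv)
  ultimately have "Max (singular_values T) = b" "Min (singular_values T) = a"
    using fin by (auto intro: Max_eqI Min_eqI)
  then show ?thesis using True inv by (simp add: cond_def)
next
  case False
  then have "a = 0" using a by simp
  then have "\<not> invertible T"
    unfolding invertible_iff_no_null_vector using ext by (auto simp: extremal_eigenvalues_def)
  then show ?thesis using False by (simp add: cond_def)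
qed

lemmas cond_weighted_sum = cond_eq[OF ctranspose_weighted_sum self_adjoint_weighted_sum]

section \<open>Equivalence of the two problems\<close>

text \<open>
  A singular operator has infinite condition number, so let \<open>c\<close> give extreme eigenvalues
  \<open>0 < a \<le> b\<close>. Compare \<open>c'\<close> with the optimally scaled \<open>c\<close>, whose distance to the identity is
  \<open>(b - a) / (b + a) < 1\<close>. That forces \<open>c'\<close> to give an invertible operator and bounds its own ratio.
\<close>

lemma solves_O_imp_cond_le:
  assumes opt: "solves_O \<phi> c'" and c: "\<And>i. 0 \<le> c i"
  shows "cond (weighted_sum \<phi> c') \<le> cond (weighted_sum \<phi> c)"
proof -
  have c': "0 \<le> c' i" for i using opt by (simp add: solves_O_def is_arg_min_def)
  have min: "op_norm (mat 1 - weighted_sum \<phi> c') \<le> op_norm (mat 1 - weighted_sum \<phi> e)"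
    if "\<And>i. 0 \<le> e i" for e
    using opt that by (auto simp: solves_O_def is_arg_min_def not_less)
  obtain a b where ab: "extremal_eigenvalues ((*v) (weighted_sum \<phi> c)) a b"
    using extremal_eigenvalues_exist[OF self_adjoint_weighted_sum] by blast
  obtain a' b' where ab': "extremal_eigenvalues ((*v) (weighted_sum \<phi> c')) a' b'"
    using extremal_eigenvalues_exist[OF self_adjoint_weighted_sum] by blast
  have a: "0 \<le> a" using smallest_eigenvalue_nonneg[OF c ab] .
  have a': "0 \<le> a'" using smallest_eigenvalue_nonneg[OF c' ab'] .
  show ?thesis
  proof (cases "0 < a")
    case False
    then show ?thesis using cond_weighted_sum[OF ab a] by simp
  next
    case True
    note le = extremal_eigenvalues_le[OF ab] and le' = extremal_eigenvalues_le[OF ab']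
    have "op_norm (mat 1 - weighted_sum \<phi> c')
        \<le> op_norm (mat 1 - weighted_sum \<phi> (\<lambda>i. 2 / (a + b) * c i))"
      using True le c by (intro min) simp
    then have bound: "max \<bar>1 - a'\<bar> \<bar>1 - b'\<bar> \<le> (b - a) / (b + a)"
      by (simp only: op_norm_weighted_sum[OF ab'] op_norm_scaled_weighted_sum[OF ab True])
    also have "\<dots> < 1" using True le by simp
    finally have "0 < a'" by (simp add: abs_less_iff)
    have "(b' - a') / (b' + a') \<le> (b - a) / (b + a)"
      using dist_one_ge_ratio[OF \<open>0 < a'\<close> le'] bound by linarith
    then have "b' / a' \<le> b / a" using ratio_le_iff[OF True le \<open>0 < a'\<close> le'] by simp
    then show ?thesis
      using cond_weighted_sum[OF ab a] cond_weighted_sum[OF ab' a'] True \<open>0 < a'\<close> by simp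
  qed
qed

text \<open>The lower frame bound bounds the smallest eigenvalue of \<open>\<Phi> \<Phi>\<^sup>*\<close> away from \<open>0\<close>.\<close>

lemma frame_cond_finite:
  assumes "frame \<phi>"
  shows "cond (weighted_sum \<phi> (\<lambda>_. 1)) < \<infinity>"
proof -
  obtain A where A: "0 < A" "\<And>x. A * (norm x)\<^sup>2 \<le> (\<Sum>i\<in>UNIV. (norm (sinner x (\<phi> i)))\<^sup>2)"
    using assms unfolding frame_def by blast
  obtain a b where ab: "extremal_eigenvalues ((*v) (weighted_sum \<phi> (\<lambda>_. 1))) a b"
    using extremal_eigenvalues_exist[OF self_adjoint_weighted_sum] by blast
  have "A \<le> a" using ab by (rule extremal_eigenvalues_ge) (simp add: inner_weighted_sum_self A(2))
  then show ?thesis using A(1) cond_weighted_sum[OF ab] by simp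
qed

lemma solves_C_imp_scaled_solves_O:
  assumes fr: "frame \<phi>" and opt: "solves_C \<phi> d"
  shows "\<exists>t>0. solves_O \<phi> (\<lambda>i. t * d i)"
proof -
  have d: "0 \<le> d i" for i using opt by (simp add: solves_C_def is_arg_min_def)
  have min: "cond (weighted_sum \<phi> d) \<le> cond (weighted_sum \<phi> e)" if "\<And>i. 0 \<le> e i" for e
    using opt that by (auto simp: solves_C_def is_arg_min_def not_less)
  obtain a b where ab: "extremal_eigenvalues ((*v) (weighted_sum \<phi> d)) a b"
    using extremal_eigenvalues_exist[OF self_adjoint_weighted_sum] by blast
  note le = extremal_eigenvalues_le[OF ab]
  have a: "0 \<le> a" using smallest_eigenvalue_nonneg[OF d ab] .
  have "cond (weighted_sum \<phi> d) < \<infinity>"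
    using min[of "\<lambda>_. 1"] frame_cond_finite[OF fr] by (rule order_le_less_trans) simp
  then have "0 < a" using cond_weighted_sum[OF ab a] by (simp split: if_splits)
  define t where "t = 2 / (a + b)"
  have "t > 0" using \<open>0 < a\<close> le by (simp add: t_def)
  have "(b - a) / (b + a) \<le> op_norm (mat 1 - weighted_sum \<phi> e)" if e: "\<And>i. 0 \<le> e i" for e
  proof -
    obtain a' b' where ab': "extremal_eigenvalues ((*v) (weighted_sum \<phi> e)) a' b'"
      using extremal_eigenvalues_exist[OF self_adjoint_weighted_sum] by blast
    note le' = extremal_eigenvalues_le[OF ab']
    have a': "0 \<le> a'" using smallest_eigenvalue_nonneg[OF e ab'] .
    show ?thesis
    proof (cases "0 < a'")
      case True
      have "b / a \<le> b' / a'"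
        using min[of e, OF e] cond_weighted_sum[OF ab a] cond_weighted_sum[OF ab' a'] True \<open>0 < a\<close> by simp
      then have "(b - a) / (b + a) \<le> (b' - a') / (b' + a')"
        using ratio_le_iff[OF True le' \<open>0 < a\<close> le] by simp
      also have "\<dots> \<le> op_norm (mat 1 - weighted_sum \<phi> e)"
        using dist_one_ge_ratio[OF True le'] by (simp add: op_norm_weighted_sum[OF ab'])
      finally show ?thesis .
    next
      \<comment> \<open>a singular operator is at distance at least \<open>1\<close> from the identity\<close>
      case False
      have "(b - a) / (b + a) \<le> 1" using \<open>0 < a\<close> le by simp
      also have "1 \<le> op_norm (mat 1 - weighted_sum \<phi> e)"
        using False a' by (simp add: op_norm_weighted_sum[OF ab'])
      finally show ?thesis .
    qed
  qed
  then have "solves_O \<phi> (\<lambda>i. t * d i)"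
    using d \<open>t > 0\<close> op_norm_scaled_weighted_sum[OF ab \<open>0 < a\<close>]
    by (auto simp: solves_O_def is_arg_min_def not_less t_def[symmetric])
  then show ?thesis using \<open>t > 0\<close> by blast
qed

theorem theorem6:
  fixes \<phi> :: "'m::finite \<Rightarrow> ('k::real_or_complex) ^ 'n"
  assumes "frame \<phi>"
  shows "(\<forall>c'. solves_O \<phi> c' \<longrightarrow>
            (\<forall>c. (\<forall>i. 0 \<le> c i) \<longrightarrow> cond (weighted_sum \<phi> c') \<le> cond (weighted_sum \<phi> c)))
       \<and> (\<forall>d. solves_C \<phi> d \<longrightarrow> (\<exists>c>0. solves_O \<phi> (\<lambda>i. c * d i)))
       \<and> (\<forall>c'. solves_O \<phi> c' \<longrightarrow>
            cond (weighted_sum \<phi> c') \<le> cond (frame_matrix \<phi> ** ctranspose (frame_matrix \<phi>)))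
       \<and> frame_matrix \<phi> ** ctranspose (frame_matrix \<phi>) = (\<Sum>i\<in>UNIV. outer (\<phi> i))"
proof -
  have "frame_matrix \<phi> ** ctranspose (frame_matrix \<phi>) = weighted_sum \<phi> (\<lambda>_. 1)"
    by (simp add: frame_matrix_mult_ctranspose weighted_sum_def)
  then have "cond (weighted_sum \<phi> c') \<le> cond (frame_matrix \<phi> ** ctranspose (frame_matrix \<phi>))"
    if "solves_O \<phi> c'" for c'
    using solves_O_imp_cond_le[OF that, of "\<lambda>_. 1"] by simp
  then show ?thesis
    using solves_O_imp_cond_le solves_C_imp_scaled_solves_O[OF assms] frame_matrix_mult_ctranspose
    by blast
qed

end
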